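(* Let $k\ge 1$ be an integer. If a finite simple graph $G$ is strongly $k$-choosable, then it is also strongly $km$-choosable for every positive integer $m$.
   Context: A graph is $n$-choosable if for every assignment of sets $S(v)$ of size $n$ to its vertices there is a proper vertex colouring assigning each vertex $v$ a colour from $S(v)$. A graph $G=(V,E)$ is strongly $n$-choosable if for every collection $V_1,\dots,V_r$ of pairwise disjoint subsets of $V$, each of size at most $n$, the graph obtained from $G$ by adding all edges between distinct vertices within each $V_i$ is $n$-choosable. *)

theory Defs
  imports "Graph_Theory.Pair_Digraph" "HOL-Library.Disjoint_Sets"
begin

text \<open>Finite simple graphs are \<^const>\<open>pair_graph\<close>s: finite, loop-free, with a symmetric set of
  arcs. An undirected edge is a pair of opposite arcs.\<close>

definition proper_colouring :: "'a pair_pre_digraph \<Rightarrow> ('a \<Rightarrow> 'c) \<Rightarrow> bool" where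
  "proper_colouring G c \<longleftrightarrow> (\<forall>(u, v) \<in> parcs G. c u \<noteq> c v)"

text \<open>A definition cannot quantify over the type of colours, so colours are natural numbers. For
  finite graphs this is no restriction: see \<open>choosable_any_colours\<close> below.\<close>

definition choosable :: "nat \<Rightarrow> 'a pair_pre_digraph \<Rightarrow> bool" where
  "choosable n G \<longleftrightarrow>
    (\<forall>S :: 'a \<Rightarrow> nat set. (\<forall>v \<in> pverts G. finite (S v) \<and> card (S v) = n) \<longrightarrow>
      (\<exists>c. proper_colouring G c \<and> (\<forall>v \<in> pverts G. c v \<in> S v)))"

definition add_cliques :: "'a pair_pre_digraph \<Rightarrow> 'i set \<Rightarrow> ('i \<Rightarrow> 'a set) \<Rightarrow> 'a pair_pre_digraph" where
  "add_cliques G I V =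
    \<lparr>pverts = pverts G,
     parcs = parcs G \<union> {(u, v). u \<noteq> v \<and> (\<exists>i \<in> I. u \<in> V i \<and> v \<in> V i)}\<rparr>"

definition strongly_choosable :: "nat \<Rightarrow> 'a pair_pre_digraph \<Rightarrow> bool" where
  "strongly_choosable n G \<longleftrightarrow>
    (\<forall>(r :: nat) (V :: nat \<Rightarrow> 'a set).
      (\<forall>i \<in> {1..r}. V i \<subseteq> pverts G \<and> finite (V i) \<and> card (V i) \<le> n) \<and>
      disjoint_family_on V {1..r} \<longrightarrow>
      choosable n (add_cliques G {1..r} V))"

lemma pair_graph_add_cliques:
  assumes "pair_graph G" and "\<And>i. i \<in> I \<Longrightarrow> V i \<subseteq> pverts G"
  shows "pair_graph (add_cliques G I V)"
proof -
  interpret pair_graph G by fact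
  let ?H = "add_cliques G I V"
  have sub: "parcs ?H \<subseteq> pverts G \<times> pverts G"
    using assms(2) by (fastforce simp: add_cliques_def dest: in_arcsD1 in_arcsD2)
  have fin: "finite (parcs ?H)"
    using sub pair_finite_verts by (meson finite_SigmaI finite_subset)
  have sym: "sym (parcs ?H)"
    by (auto simp: sym_def add_cliques_def intro: arcs_symmetric)
  have verts: "pverts ?H = pverts G"
    by (simp add: add_cliques_def)
  have loops: "fst e \<noteq> snd e" if "e \<in> parcs ?H" for e
    using that by (auto simp: add_cliques_def dest: pair_no_loops)
  show ?thesis
    using sub fin sym verts loops pair_finite_verts
    by unfold_locales (auto simp: symmetric_def)
qed

lemma choosable_any_colours:
  fixes S :: "'a \<Rightarrow> 'c set"
  assumes G: "pair_graph G" and ch: "choosable n G"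
    and S: "\<And>v. v \<in> pverts G \<Longrightarrow> finite (S v) \<and> card (S v) = n"
  shows "\<exists>c. proper_colouring G c \<and> (\<forall>v \<in> pverts G. c v \<in> S v)"
proof -
  interpret pair_graph G by fact
  define U where "U = (\<Union>v \<in> pverts G. S v)"
  have "finite U"
    using S pair_finite_verts by (auto simp: U_def)
  then obtain f :: "'c \<Rightarrow> nat" where f: "inj_on f U"
    using finite_imp_inj_to_nat_seg by metis
  have sub: "S v \<subseteq> U" if "v \<in> pverts G" for v
    using that by (auto simp: U_def)
  have "\<forall>v \<in> pverts G. finite (f ` S v) \<and> card (f ` S v) = n"
    using S sub f by (metis card_image finite_imageI inj_on_subset)
  then obtain c where c: "proper_colouring G c" "\<forall>v \<in> pverts G. c v \<in> f ` S v"
    using ch[unfolded choosable_def, rule_format, of "\<lambda>v. f ` S v"] by blast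
  define d where "d v = inv_into U f (c v)" for v
  have d: "d v \<in> S v \<and> f (d v) = c v" if v: "v \<in> pverts G" for v
  proof -
    obtain x where "x \<in> S v" "c v = f x"
      using c(2) v by blast
    then show ?thesis
      using sub[OF v] f by (auto simp: d_def)
  qed
  have "d u \<noteq> d v" if "(u, v) \<in> parcs G" for u v
    using d[OF in_arcsD1[OF that]] d[OF in_arcsD2[OF that]] c(1) that
    by (fastforce simp: proper_colouring_def)
  then show ?thesis
    using d by (auto simp: proper_colouring_def)
qed

end

theory Submission
  imports Defs
begin

text \<open>Each clique \<open>V i\<close> of size at most \<open>k * m\<close> is cut into \<open>m\<close> groups of size at most \<open>k\<close>, and
  the colours are split among the groups such that every vertex finds at least \<open>k\<close> of its \<open>k * m\<close>
  colours in the share of its group. After shrinking the lists accordingly, vertices in different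
  groups of the same \<open>V i\<close> can never receive the same colour, so strong \<open>k\<close>-choosability, applied
  to the groups, yields the colouring. The splitting is a moving-knife argument: let the share
  \<open>A\<close> of the first group grow, one colour at a time, until \<open>k\<close> vertices have at least \<open>k\<close> colours
  in \<open>A\<close>. At that moment fewer than \<open>k\<close> vertices have more than \<open>k\<close> colours in \<open>A\<close>; putting these
  into the first group leaves every other vertex with at least \<open>k * (m - 1)\<close> colours outside \<open>A\<close>.\<close>

definition satisfied :: "'a set \<Rightarrow> ('a \<Rightarrow> 'c set) \<Rightarrow> nat \<Rightarrow> 'c set \<Rightarrow> 'a set" where
  "satisfied V S k A = {v \<in> V. k \<le> card (S v \<inter> A)}"

lemma satisfied_Suc_insert_subset:
  "satisfied V S (Suc k) (insert a A) \<subseteq> satisfied V S k A"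
proof
  fix v
  assume "v \<in> satisfied V S (Suc k) (insert a A)"
  then have "v \<in> V" and "Suc k \<le> card (S v \<inter> insert a A)"
    by (simp_all add: satisfied_def)
  moreover have "card (S v \<inter> insert a A) \<le> Suc (card (S v \<inter> A))"
    by (simp add: Int_insert_right card_insert_le_m1)
  ultimately show "v \<in> satisfied V S k A"
    by (simp add: satisfied_def)
qed

lemma satisfied_moving_knife:
  assumes "finite U" and "finite V" and "n \<le> card (satisfied V S k U)"
  shows "\<exists>A. card (satisfied V S (Suc k) A) \<le> n \<and> n \<le> card (satisfied V S k A)"
  using assms(1,3)
proof (induction U rule: finite_induct)
  case empty
  have "satisfied V S (Suc k) {} = {}"
    by (simp add: satisfied_def)
  then show ?case
    using empty by (metis card.empty le0)
next
  case (insert a U)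
  show ?case
  proof (cases "n \<le> card (satisfied V S k U)")
    case True
    then show ?thesis
      by (rule insert.IH)
  next
    case False
    have "finite (satisfied V S k U)"
      using \<open>finite V\<close> by (simp add: satisfied_def)
    then have "card (satisfied V S (Suc k) (insert a U)) \<le> card (satisfied V S k U)"
      using satisfied_Suc_insert_subset by (rule card_mono)
    then show ?thesis
      using False insert.prems by (meson nat_le_linear order.trans)
  qed
qed

lemma satisfied_between_moving_knife:
  assumes "finite U" and "finite V" and "n \<le> card (satisfied V S k U)"
  obtains T A where "card T = n" "satisfied V S (Suc k) A \<subseteq> T" "T \<subseteq> satisfied V S k A"
proof -
  obtain A where few: "card (satisfied V S (Suc k) A) \<le> n"
    and many: "n \<le> card (satisfied V S k A)"
    using satisfied_moving_knife[OF assms] by blast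
  have "satisfied V S (Suc k) A \<subseteq> satisfied V S k A" "finite (satisfied V S k A)"
    using \<open>finite V\<close> by (auto simp: satisfied_def)
  then show thesis
    using exists_subset_between[OF few many] that by metis
qed

lemma split_lists_in_two:
  fixes S :: "'a \<Rightarrow> 'c set"
  assumes "finite V" and card_V: "card V \<le> k + l"
    and finite_lists: "\<And>v. v \<in> V \<Longrightarrow> finite (S v)"
    and card_lists: "\<And>v. v \<in> V \<Longrightarrow> k + l \<le> card (S v)"
  obtains T A where "T \<subseteq> V" "card T \<le> k" "card (V - T) \<le> l"
    "\<And>v. v \<in> T \<Longrightarrow> k \<le> card (S v \<inter> A)" "\<And>v. v \<in> V - T \<Longrightarrow> l \<le> card (S v - A)"
proof (cases "card V \<le> k")
  case True
  have "k \<le> card (S v \<inter> UNIV)" if "v \<in> V" for v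
    using card_lists[OF that] by simp
  then show thesis
    using True by (intro that[of V UNIV]) auto
next
  case False
  have "k \<le> card (S v \<inter> \<Union>(S ` V))" if "v \<in> V" for v
    using card_lists[OF that] that by (simp add: Int_absorb2 UN_upper)
  then have "satisfied V S k (\<Union>(S ` V)) = V"
    by (auto simp: satisfied_def)
  then obtain T A where card_T: "card T = k"
    and T_between: "satisfied V S (Suc k) A \<subseteq> T" "T \<subseteq> satisfied V S k A"
    using satisfied_between_moving_knife[of "\<Union>(S ` V)" V k S k]
      \<open>finite V\<close> finite_lists False by auto
  show thesis
  proof (rule that)
    show "T \<subseteq> V" and "\<And>v. v \<in> T \<Longrightarrow> k \<le> card (S v \<inter> A)"
      using T_between(2) by (auto simp: satisfied_def)
    then show "card (V - T) \<le> l"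
      using \<open>finite V\<close> card_V card_T by (simp add: card_Diff_subset finite_subset)
    show "card T \<le> k"
      using card_T by simp
    show "l \<le> card (S v - A)" if "v \<in> V - T" for v
    proof -
      have "card (S v \<inter> A) \<le> k"
        using that T_between(1) by (auto simp: satisfied_def)
      moreover have "card (S v) = card (S v \<inter> A) + card (S v - A)"
        using finite_lists that by (simp add: card_Int_Diff)
      ultimately show ?thesis
        using card_lists[of v] that by simp
    qed
  qed
qed

text \<open>Here \<open>g v\<close> is the group of the vertex \<open>v\<close>, and \<open>f x\<close> the group whose share contains the
  colour \<open>x\<close>.\<close>

definition list_splitting ::
    "'j set \<Rightarrow> ('j \<Rightarrow> nat) \<Rightarrow> 'a set \<Rightarrow> ('a \<Rightarrow> 'c set) \<Rightarrow> ('a \<Rightarrow> 'j) \<Rightarrow> ('c \<Rightarrow> 'j) \<Rightarrow> bool" where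
  "list_splitting J n V S g f \<longleftrightarrow>
    (\<forall>j \<in> J. card (V \<inter> g -` {j}) \<le> n j) \<and>
    (\<forall>v \<in> V. g v \<in> J \<and> n (g v) \<le> card (S v \<inter> f -` {g v}))"

lemma list_splitting_insert:
  fixes g :: "'a \<Rightarrow> 'j" and f :: "'c \<Rightarrow> 'j"
  assumes splitting: "list_splitting J n (V - T) (\<lambda>v. S v - A) g f"
    and "j \<notin> J" and "T \<subseteq> V" and "card T \<le> n j"
    and finite_lists: "\<And>v. v \<in> V \<Longrightarrow> finite (S v)"
    and share: "\<And>v. v \<in> T \<Longrightarrow> n j \<le> card (S v \<inter> A)"
  shows "list_splitting (insert j J) n V S
    (\<lambda>v. if v \<in> T then j else g v) (\<lambda>x. if x \<in> A then j else f x)"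
    (is "list_splitting _ _ _ _ ?g ?f")
proof -
  have group_j: "V \<inter> ?g -` {j} = T"
    using splitting \<open>j \<notin> J\<close> \<open>T \<subseteq> V\<close> by (auto simp: list_splitting_def split: if_splits)
  have group_i: "V \<inter> ?g -` {i} = (V - T) \<inter> g -` {i}" if "i \<in> J" for i
    using that \<open>j \<notin> J\<close> by auto
  have "card (V \<inter> ?g -` {i}) \<le> n i" if "i \<in> insert j J" for i
    using that group_j group_i splitting \<open>card T \<le> n j\<close> by (auto simp: list_splitting_def)
  moreover have "?g v \<in> insert j J \<and> n (?g v) \<le> card (S v \<inter> ?f -` {?g v})" if "v \<in> V" for v
  proof (cases "v \<in> T")
    case True
    have "card (S v \<inter> A) \<le> card (S v \<inter> ?f -` {j})"
      using finite_lists[OF that] by (intro card_mono) auto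
    then show ?thesis
      using True share[OF True] by simp
  next
    case False
    then have "g v \<in> J" "n (g v) \<le> card ((S v - A) \<inter> f -` {g v})"
      using that splitting by (auto simp: list_splitting_def)
    moreover have "card ((S v - A) \<inter> f -` {g v}) \<le> card (S v \<inter> ?f -` {g v})"
      using finite_lists[OF that] by (intro card_mono) auto
    ultimately show ?thesis
      using False by simp
  qed
  ultimately show ?thesis
    by (simp add: list_splitting_def)
qed

lemma list_splitting_exists:
  fixes S :: "'a \<Rightarrow> 'c set"
  assumes "finite J" and "finite V" and "card V \<le> sum n J"
    and "\<And>v. v \<in> V \<Longrightarrow> finite (S v)" and "\<And>v. v \<in> V \<Longrightarrow> sum n J \<le> card (S v)"
  shows "\<exists>g f. list_splitting J n V S g f"
  using assms
proof (induction J arbitrary: V S rule: finite_induct)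
  case empty
  then show ?case
    by (simp add: list_splitting_def)
next
  case (insert j J)
  then have sum_insert: "sum n (insert j J) = n j + sum n J"
    by simp
  obtain T A where group: "T \<subseteq> V" "card T \<le> n j" "\<And>v. v \<in> T \<Longrightarrow> n j \<le> card (S v \<inter> A)"
    and rest: "card (V - T) \<le> sum n J" "\<And>v. v \<in> V - T \<Longrightarrow> sum n J \<le> card (S v - A)"
    using split_lists_in_two[of V "n j" "sum n J" S] insert.prems unfolding sum_insert by metis
  have "\<exists>g f. list_splitting J n (V - T) (\<lambda>v. S v - A) g f"
    using rest insert.prems(1,3) by (intro insert.IH) auto
  then obtain g f where "list_splitting J n (V - T) (\<lambda>v. S v - A) g f"
    by blast
  from list_splitting_insert[OF this insert.hyps(2) group(1,2) insert.prems(3) group(3)] show ?case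
    by blast
qed

lemma pverts_add_cliques [simp]: "pverts (add_cliques G I V) = pverts G"
  by (simp add: add_cliques_def)

lemma add_cliques_image: "add_cliques G (h ` I) V = add_cliques G I (V \<circ> h)"
  by (simp add: add_cliques_def)

lemma proper_colouring_add_cliques_iff:
  "proper_colouring (add_cliques G I V) c \<longleftrightarrow>
    proper_colouring G c \<and> (\<forall>i \<in> I. inj_on c (V i))"
  by (fastforce simp: proper_colouring_def add_cliques_def inj_on_def)

lemma choosable_large_lists:
  fixes S :: "'a \<Rightarrow> nat set"
  assumes "choosable n G" and large: "\<And>v. v \<in> pverts G \<Longrightarrow> n \<le> card (S v)"
  obtains c where "proper_colouring G c" "\<And>v. v \<in> pverts G \<Longrightarrow> c v \<in> S v"
proof -
  have "\<exists>L \<subseteq> S v. finite L \<and> card L = n" if "v \<in> pverts G" for v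
    using obtain_subset_with_card_n[OF large[OF that]] by metis
  then obtain L
    where sublists: "\<And>v. v \<in> pverts G \<Longrightarrow> L v \<subseteq> S v \<and> finite (L v) \<and> card (L v) = n"
    by metis
  then obtain c where "proper_colouring G c" "\<forall>v \<in> pverts G. c v \<in> L v"
    using assms(1)[unfolded choosable_def, rule_format, of L] by blast
  then show thesis
    using sublists that by blast
qed

lemma strongly_choosable_imp_choosable_add_cliques:
  assumes "strongly_choosable n G" and "finite I" and disjoint: "disjoint_family_on V I"
    and cliques: "\<And>i. i \<in> I \<Longrightarrow> V i \<subseteq> pverts G \<and> finite (V i) \<and> card (V i) \<le> n"
  shows "choosable n (add_cliques G I V)"
proof -
  obtain h where bij_h: "bij_betw h {1..card I} I"
    using ex_bij_betw_nat_finite_1[OF \<open>finite I\<close>] by blast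
  then have image_h: "h ` {1..card I} = I"
    by (rule bij_betw_imp_surj_on)
  have "disjoint_family_on (V \<circ> h) {1..card I}"
    using disjoint image_h bij_betw_imp_inj_on[OF bij_h]
    unfolding disjoint_family_on_def inj_on_def comp_def by blast
  moreover have "\<forall>i \<in> {1..card I}.
      (V \<circ> h) i \<subseteq> pverts G \<and> finite ((V \<circ> h) i) \<and> card ((V \<circ> h) i) \<le> n"
    using cliques image_h by auto
  ultimately have "choosable n (add_cliques G {1..card I} (V \<circ> h))"
    using assms(1) by (simp add: strongly_choosable_def)
  then show ?thesis
    using add_cliques_image[of G h "{1..card I}" V] image_h by simp
qed

lemma disjoint_family_on_fibres:
  fixes g :: "'i \<Rightarrow> 'a \<Rightarrow> 'j"
  assumes "disjoint_family_on V I"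
  shows "disjoint_family_on (\<lambda>(i, j). V i \<inter> g i -` {j}) (I \<times> J)"
  unfolding disjoint_family_on_def
proof clarsimp
  fix i i' and j j' :: 'j
  assume "i \<in> I" "i' \<in> I" "i = i' \<longrightarrow> j \<noteq> j'"
  then show "V i \<inter> g i -` {j} \<inter> (V i' \<inter> g i' -` {j'}) = {}"
    using disjoint_family_onD[OF assms, of i i'] by (cases "i = i'") auto
qed

lemma inj_on_if_inj_on_fibres:
  assumes recover: "\<And>x. x \<in> A \<Longrightarrow> f (c x) = g x"
    and inj_fibres: "\<And>x. x \<in> A \<Longrightarrow> inj_on c (A \<inter> g -` {g x})"
  shows "inj_on c A"
proof (rule inj_onI)
  fix x y
  assume "x \<in> A" "y \<in> A" "c x = c y"
  then have "g x = g y"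
    using recover by metis
  then show "x = y"
    using inj_fibres[OF \<open>x \<in> A\<close>] \<open>x \<in> A\<close> \<open>y \<in> A\<close> \<open>c x = c y\<close> by (simp add: inj_on_def)
qed

definition compatible_colours ::
    "'i set \<Rightarrow> ('i \<Rightarrow> 'a set) \<Rightarrow> ('a \<Rightarrow> 'c set) \<Rightarrow> ('i \<Rightarrow> 'a \<Rightarrow> 'j) \<Rightarrow> ('i \<Rightarrow> 'c \<Rightarrow> 'j) \<Rightarrow> 'a \<Rightarrow> 'c set"
  where "compatible_colours I V S g f v = {x \<in> S v. \<forall>i \<in> I. v \<in> V i \<longrightarrow> f i x = g i v}"

lemma card_compatible_colours_ge:
  assumes disjoint: "disjoint_family_on V I"
    and splittings: "\<And>i. i \<in> I \<Longrightarrow> list_splitting J (\<lambda>_. k) (V i) S (g i) (f i)"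
    and "k \<le> card (S v)"
  shows "k \<le> card (compatible_colours I V S g f v)"
proof (cases "\<exists>i \<in> I. v \<in> V i")
  case True
  then obtain i where "i \<in> I" "v \<in> V i"
    by blast
  have "i' = i" if "i' \<in> I" "v \<in> V i'" for i'
    using disjoint \<open>i \<in> I\<close> \<open>v \<in> V i\<close> that unfolding disjoint_family_on_def by blast
  then have "compatible_colours I V S g f v = S v \<inter> f i -` {g i v}"
    using \<open>i \<in> I\<close> \<open>v \<in> V i\<close> unfolding compatible_colours_def by blast
  then show ?thesis
    using splittings[OF \<open>i \<in> I\<close>] \<open>v \<in> V i\<close> by (simp add: list_splitting_def)
next
  case False
  then have "compatible_colours I V S g f v = S v"
    by (auto simp: compatible_colours_def)
  then show ?thesis
    using assms(3) by simp
qed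

lemma list_colouring_add_cliques_if_list_splittings:
  fixes S :: "'a \<Rightarrow> nat set"
  assumes "strongly_choosable k G" and "finite I" and "finite J"
    and disjoint: "disjoint_family_on V I"
    and cliques: "\<And>i. i \<in> I \<Longrightarrow> V i \<subseteq> pverts G \<and> finite (V i)"
    and lists: "\<And>v. v \<in> pverts G \<Longrightarrow> k \<le> card (S v)"
    and splittings: "\<And>i. i \<in> I \<Longrightarrow> list_splitting J (\<lambda>_. k) (V i) S (g i) (f i)"
  shows "\<exists>c. proper_colouring (add_cliques G I V) c \<and> (\<forall>v \<in> pverts G. c v \<in> S v)"
proof -
  let ?W = "\<lambda>(i, j). V i \<inter> g i -` {j}" and ?R = "compatible_colours I V S g f"
  have "choosable k (add_cliques G (I \<times> J) ?W)"
    using assms(1-3) disjoint_family_on_fibres[OF disjoint] cliques splittings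
    by (intro strongly_choosable_imp_choosable_add_cliques) (auto simp: list_splitting_def)
  moreover have "k \<le> card (?R v)" if "v \<in> pverts G" for v
    using disjoint splittings lists[OF that] by (rule card_compatible_colours_ge)
  ultimately obtain c where "proper_colouring (add_cliques G (I \<times> J) ?W) c"
    and c_compatible: "\<And>v. v \<in> pverts G \<Longrightarrow> c v \<in> ?R v"
    using choosable_large_lists[of k "add_cliques G (I \<times> J) ?W" ?R] by auto
  then have "proper_colouring G c"
    and inj_on_groups: "\<And>i j. i \<in> I \<Longrightarrow> j \<in> J \<Longrightarrow> inj_on c (V i \<inter> g i -` {j})"
    by (auto simp: proper_colouring_add_cliques_iff)
  have "inj_on c (V i)" if "i \<in> I" for i
  proof (rule inj_on_if_inj_on_fibres)
    show "f i (c v) = g i v" if "v \<in> V i" for v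
      using c_compatible cliques \<open>i \<in> I\<close> that by (auto simp: compatible_colours_def)
    show "inj_on c (V i \<inter> g i -` {g i v})" if "v \<in> V i" for v
      using inj_on_groups splittings \<open>i \<in> I\<close> that by (simp add: list_splitting_def)
  qed
  then have "proper_colouring (add_cliques G I V) c"
    using \<open>proper_colouring G c\<close> by (simp add: proper_colouring_add_cliques_iff)
  then show ?thesis
    using c_compatible by (auto simp: compatible_colours_def)
qed

theorem theorem8:
  fixes G :: "'a pair_pre_digraph" and k m :: nat
  assumes "pair_graph G" and "k \<ge> 1" and "strongly_choosable k G" and "m \<ge> 1"
  shows "strongly_choosable (k * m) G"
  unfolding strongly_choosable_def choosable_def pverts_add_cliques
proof (intro allI impI, elim conjE)
  fix r :: nat and V :: "nat \<Rightarrow> 'a set" and S :: "'a \<Rightarrow> nat set"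
  assume cliques: "\<forall>i \<in> {1..r}. V i \<subseteq> pverts G \<and> finite (V i) \<and> card (V i) \<le> k * m"
    and disjoint: "disjoint_family_on V {1..r}"
    and lists: "\<forall>v \<in> pverts G. finite (S v) \<and> card (S v) = k * m"
  have "\<exists>g f. list_splitting {..<m} (\<lambda>_. k) (V i) S g f" if "i \<in> {1..r}" for i
    using cliques lists that by (intro list_splitting_exists) (auto simp: mult.commute subset_iff)
  then obtain g f
    where "\<And>i. i \<in> {1..r} \<Longrightarrow> list_splitting {..<m} (\<lambda>_. k) (V i) S (g i) (f i)"
    by metis
  then show "\<exists>c. proper_colouring (add_cliques G {1..r} V) c \<and> (\<forall>v \<in> pverts G. c v \<in> S v)"
    using assms(3,4) cliques disjoint lists
    by (intro list_colouring_add_cliques_if_list_splittings[where J = "{..<m}"]) auto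
qed

end
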